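(* Let $L$ be a checkerboard colorable virtual link diagram, and let $\widehat G_L$ be a signed ribbon graph corresponding to $L$ (for any choice of a set of classical crossings of $L$ whose switching makes $L$ alternating). Then $$[L](A,B,d) \;=\; A^{r(\widehat G_L)}\, B^{n(\widehat G_L)}\, d^{\,k(\widehat G_L)-1}\; R_{\widehat G_L}\!\left(\frac{Bd}{A},\ \frac{Ad}{B},\ \frac{1}{d}\right),$$ where $[L]$ is the Kauffman bracket of $L$ and $R_{\widehat G_L}$ is the signed Bollobás–Riordan polynomial of $\widehat G_L$.
   Context: **Virtual link diagrams.** A virtual link diagram is a generic immersion of finitely many circles in the plane, each double point of which is marked either as a classical crossing (with over/under information) or as a virtual crossing (no further information). It is alternating if, along every component, classical overcrossings and undercrossings alternate (virtual crossings are ignored). **Kauffman bracket.** At a classical crossing, the $A$-splitting is the smoothing that unites the two regions (angles) swept out by the overcrossing arc when rotated counterclockwise until it meets the undercrossing arc; the $B$-splitting is the smoothing that unites the other two angles. A state $S$ of $L$ is a choice of $A$- or $B$-splitting at each classical crossing; $\mathcal S(L)$ is the set of states. Let $\alpha(S)$, $\beta(S)$ be the numbers of $A$- and $B$-splittings in $S$, and $\delta(S)$ the number of components (closed curves) obtained from $L$ by performing all the splittings of $S$; virtual crossings are not touched and do not connect components. Then $$[L](A,B,d)=\sum_{S\in\mathcal S(L)}A^{\alpha(S)}B^{\beta(S)}d^{\,\delta(S)-1}.$$ **Ribbon graphs.** A ribbon graph $G$ is a finite undirected graph $(V,E)$ (loops and multiple edges allowed) with a cyclic order, at each vertex, on the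 edge-ends incident to it (loops counted twice). Equivalently, it is an oriented surface with boundary that is the union of closed discs ("vertices") and closed discs ("edges", i.e. ribbons), such that vertices and edges intersect in disjoint line segments, each such segment lies on the boundary of exactly one vertex and exactly one edge, and each edge contains exactly two such segments. Ribbon graphs are regarded as abstract surfaces (no embedding in 3-space). Let $v(G)=|V|$, $e(G)=|E|$, $k(G)$ = number of connected components, $r(G)=v(G)-k(G)$, $n(G)=e(G)-r(G)$, and $\mathrm{bc}(G)$ = number of connected components of the boundary of the surface $G$. A spanning subgraph contains all the vertices and a subset of the edges (with the induced ribbon structure); $\mathcal F(G)$ is the set of all spanning subgraphs. **Signed ribbon graphs.** A signed ribbon graph $\widehat G$ is a ribbon graph $G$ with a sign function $\varepsilon:E\to\{\pm1\}$; its parameters $v,e,k,r,n,\mathrm{bc}$ are those of $G$. For a spanning subgraph $F$, let $e_-(F)$ be the number of edges of $F$ with sign $-1$, let $\overline F=\widehat G-F$ be the spanning subgraph whose edges are exactly those not in $F$, and let $s(F)=\frac{e_-(F)-e_-(\overline F)}{2}$. The signed Bollobás–Riordan polynomial is $$R_{\widehat G}(x,y,z)=\sum_{F\in\mathcal F(\widehat G)}x^{r(\widehat G)-r(F)+s(F)}\,y^{n(F)-s(F)}\,z^{k(F)-\mathrm{bc}(F)+n(F)},$$ a Laurent polynomial in $x^{1/2},y^{1/2},z$. Since $2s(F)\in\mathbb Z$ and half-integer powers occur only through $x^{s(F)}y^{-s(F)}=(x^{1/2}/y^{1/2})^{2s(F)}$, evaluating it requires only a choice of $x^{1/2}/y^{1/2}$,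 a square root of $x/y$; at $x=Bd/A$, $y=Ad/B$ the choice is $x^{1/2}/y^{1/2}=B/A$. **Checkerboard coloring.** A checkerboard coloring of a virtual link diagram is a coloring (black) of one side of the diagram in a small neighborhood of it, such that near a classical crossing the coloring alternates as on a checkerboard (two opposite angles black), and near a virtual crossing the colorings of the two strands pass through without noticing each other. A diagram is checkerboard colorable if it has such a coloring. It is a known fact (N. Kamada) that a virtual link diagram is checkerboard colorable if and only if it can be made alternating by switching over/under at some set of classical crossings. An alternating diagram has a canonical checkerboard coloring: near each classical crossing, the black angles are the two vertical angles swept out by the overcrossing arc under counterclockwise rotation, i.e. those united by the $A$-splitting; since the diagram is alternating, these local colorings agree along arcs and extend to a global checkerboard coloring. **The ribbon graph $G_{\widetilde L}$ of an alternating diagram $\widetilde L$.** The canonical coloring of $\widetilde L$ is a collection of annuli (immersed in the plane, overlapping only at virtual crossings). Each annulus has an exterior circle, which runs along the link except near classical crossings, where it jumps from one strand to the other, staying within the black angle (so the exterior circles are exactly the closed curves of the state of $\widetilde L$ with all $B$-splittings), and an interior circle. The surface $G_{\widetilde L}$ is obtained by replacing each classical crossing by an edge-ribbon, untwisted with respect to the plane, connecting the two arcs of exterior circles in the two opposite black angles at that crossing (so that the two free sides of the ribbon are the two arcs of the $A$-splitting of $\widetilde L$ there), and by gluing discs along all the interior circles. The vertices of $G_{\widetilde L}$ are the annuli capped off by these discs, the edges are the ribbons, in bijection with the classical crossings of $\widetilde L$; the orientation is induced from that of the plane on the annuli and ribbons. A component without classical crossings contributes an isolated vertex. **The signed ribbon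 graph $\widehat G_L$.** Given a checkerboard colorable diagram $L$, choose a set of classical crossings whose switching turns $L$ into an alternating diagram $\widetilde L$. Then $\widehat G_L$ is the ribbon graph $G_{\widetilde L}$ with sign $-1$ on the edges corresponding to the switched crossings and $+1$ on the other edges. It depends on the choice of the switched set. *)

theory Defs
  imports "HOL-Analysis.Analysis"
begin

section \<open>Virtual link diagrams\<close>

text \<open>
  Circles are \<open>\<real>/\<int>\<close>, the plane is \<^typ>\<open>complex\<close> with its standard orientation. The \<open>i\<close>-th circle
  (\<open>i < ncomp L\<close>) is immersed by the 1-periodic map \<open>curve L i\<close>. The double points outside
  \<open>classical L\<close> are the virtual crossings. At a classical crossing \<open>c\<close>, \<open>over L c\<close> is the preimage
  of \<open>c\<close> (component, parameter) on the overcrossing strand; the values of \<open>over L\<close> elsewhere are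
  irrelevant.
\<close>

type_synonym cpoint = "nat \<times> real"

record vlink =
  ncomp :: nat
  curve :: "nat \<Rightarrow> real \<Rightarrow> complex"
  classical :: "complex set"
  over :: "complex \<Rightarrow> cpoint"

definition points :: "vlink \<Rightarrow> cpoint set" where
  "points L = {..<ncomp L} \<times> {0..<1}"

definition pos :: "vlink \<Rightarrow> cpoint \<Rightarrow> complex" where
  "pos L p = curve L (fst p) (snd p)"

definition velocity :: "vlink \<Rightarrow> cpoint \<Rightarrow> complex" where
  "velocity L p = vector_derivative (curve L (fst p)) (at (snd p))"

definition preimages :: "vlink \<Rightarrow> complex \<Rightarrow> cpoint set" where
  "preimages L c = {p \<in> points L. pos L p = c}"

definition double_points :: "vlink \<Rightarrow> complex set" where
  "double_points L = {c. \<exists>p\<in>preimages L c. \<exists>q\<in>preimages L c. p \<noteq> q}"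

text \<open>\<open>cross2 u w > 0\<close> iff \<open>w\<close> is reached from \<open>u\<close> by a counterclockwise rotation by an angle
  strictly between 0 and \<open>\<pi>\<close>.\<close>

definition cross2 :: "complex \<Rightarrow> complex \<Rightarrow> real" where
  "cross2 u w = Im (cnj u * w)"

definition generic_immersion :: "vlink \<Rightarrow> bool" where
  "generic_immersion L \<longleftrightarrow>
     (\<forall>i<ncomp L. curve L i C1_differentiable_on UNIV \<and>
        (\<forall>t. curve L i (t + 1) = curve L i t) \<and>
        (\<forall>t. vector_derivative (curve L i) (at t) \<noteq> 0)) \<and>
     finite (double_points L) \<and>
     (\<forall>c\<in>double_points L. card (preimages L c) = 2) \<and>
     (\<forall>p\<in>points L. \<forall>q\<in>points L.
        p \<noteq> q \<and> pos L p = pos L q \<longrightarrow> cross2 (velocity L p) (velocity L q) \<noteq> 0)"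

definition virtual_link_diagram :: "vlink \<Rightarrow> bool" where
  "virtual_link_diagram L \<longleftrightarrow>
     generic_immersion L \<and> classical L \<subseteq> double_points L \<and>
     (\<forall>c\<in>classical L. over L c \<in> preimages L c)"

definition under :: "vlink \<Rightarrow> complex \<Rightarrow> cpoint" where
  "under L c = (THE p. p \<in> preimages L c \<and> p \<noteq> over L c)"

definition switch :: "complex set \<Rightarrow> vlink \<Rightarrow> vlink" where
  "switch X L = L\<lparr>over := (\<lambda>c. if c \<in> X then under L c else over L c)\<rparr>"

definition classical_points :: "vlink \<Rightarrow> cpoint set" where
  "classical_points L = {p \<in> points L. pos L p \<in> classical L}"

text \<open>The first passage through a classical crossing that follows the passage \<open>p\<close> on its
  (cyclically traversed) component; it is \<open>p\<close> itself if \<open>p\<close> is the only one there.\<close>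

definition next_point :: "vlink \<Rightarrow> cpoint \<Rightarrow> cpoint" where
  "next_point L p =
     (let T = {t. (fst p, t) \<in> classical_points L}; T' = {t \<in> T. snd p < t}
      in (fst p, if T' \<noteq> {} then Min T' else Min T))"

definition is_over :: "vlink \<Rightarrow> cpoint \<Rightarrow> bool" where
  "is_over L p \<longleftrightarrow> over L (pos L p) = p"

definition alternating :: "vlink \<Rightarrow> bool" where
  "alternating L \<longleftrightarrow>
     (\<forall>p\<in>classical_points L. is_over L (next_point L p) \<longleftrightarrow> \<not> is_over L p)"


section \<open>Splittings, states and the Kauffman bracket\<close>

text \<open>
  Four half-branches emanate from a classical crossing: \<open>(p, True)\<close> leaves it, and \<open>(p, False)\<close>
  arrives at it, along the strand through the crossing at \<open>p\<close>. The classical crossings cut the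
  components passing through them into arcs, each of which has two half-branches as its ends.
\<close>

type_synonym half_branch = "cpoint \<times> bool"

definition half_branches :: "vlink \<Rightarrow> half_branch set" where
  "half_branches L = classical_points L \<times> UNIV"

definition arc :: "vlink \<Rightarrow> half_branch \<Rightarrow> half_branch \<Rightarrow> bool" where
  "arc L h h' \<longleftrightarrow> (\<exists>p\<in>classical_points L. h = (p, True) \<and> h' = (next_point L p, False))"

definition outward :: "vlink \<Rightarrow> half_branch \<Rightarrow> complex" where
  "outward L h = (if snd h then velocity L (fst h) else - velocity L (fst h))"

text \<open>\<open>angle L h h'\<close>: \<open>h'\<close> is the half-branch that follows \<open>h\<close> counterclockwise around their
  crossing. The four angles at a crossing are these pairs, so an angle is determined by its clockwise
  side \<open>h\<close>. It is swept out by the counterclockwise rotation of the overcrossing arc iff \<open>h\<close> lies on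
  the overcrossing arc.\<close>

definition angle :: "vlink \<Rightarrow> half_branch \<Rightarrow> half_branch \<Rightarrow> bool" where
  "angle L h h' \<longleftrightarrow> h \<in> half_branches L \<and> h' \<in> half_branches L \<and>
     pos L (fst h) = pos L (fst h') \<and> 0 < cross2 (outward L h) (outward L h')"

text \<open>
  A state is given by the set \<open>S \<subseteq> classical L\<close> of the crossings with an \<open>A\<close>-splitting. Uniting two
  opposite angles means that the two sides of each of the \<^emph>\<open>other\<close> two angles get joined: the
  \<open>A\<close>-splitting joins the sides of the angles whose clockwise side is under, the \<open>B\<close>-splitting those
  of the angles whose clockwise side is over.
\<close>

definition split_join :: "vlink \<Rightarrow> complex set \<Rightarrow> half_branch \<Rightarrow> half_branch \<Rightarrow> bool" where
  "split_join L S h h' \<longleftrightarrow> angle L h h' \<and>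
     (if pos L (fst h) \<in> S then \<not> is_over L (fst h) else is_over L (fst h))"

definition state_curve_rel :: "vlink \<Rightarrow> complex set \<Rightarrow> half_branch rel" where
  "state_curve_rel L S = {(h, h'). equivclp (\<lambda>a b. arc L a b \<or> split_join L S a b) h h'}"

definition crossing_free :: "vlink \<Rightarrow> nat set" where
  "crossing_free L = {i. i < ncomp L \<and> (\<forall>t. (i, t) \<notin> classical_points L)}"

text \<open>The closed curves of a state: \<open>Inl K\<close> is the curve running through the half-branches in \<open>K\<close>,
  and \<open>Inr i\<close> is the component \<open>i\<close> of the diagram if it passes through no classical crossing.\<close>

definition state_curves :: "vlink \<Rightarrow> complex set \<Rightarrow> (half_branch set + nat) set" where
  "state_curves L S = Inl ` (half_branches L // state_curve_rel L S) \<union> Inr ` crossing_free L"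

text \<open>In this and the other polynomials below, the variables are evaluated at units of a field. As
  the field is arbitrary, they may be taken to be indeterminates over any field of constants.\<close>

definition kauffman_bracket :: "vlink \<Rightarrow> 'a \<Rightarrow> 'a \<Rightarrow> 'a \<Rightarrow> 'a::field" where
  "kauffman_bracket L A B d =
     (\<Sum>S\<in>Pow (classical L).
        A ^ card S * B ^ card (classical L - S) * d powi (int (card (state_curves L S)) - 1))"


section \<open>Checkerboard colorings\<close>

text \<open>
  A coloring is given by the set \<open>K\<close> of the clockwise sides of the black angles. The angles must
  alternate in color around each crossing. If an arc has ends \<open>h\<close> and \<open>h'\<close>, then the side of the arc
  following \<open>h\<close> counterclockwise is the one that \<^emph>\<open>precedes\<close> \<open>h'\<close> counterclockwise; the color is
  constant along each side of an arc (also past virtual crossings) and differs on its two sides,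
  whence the second condition. Components without classical crossings can be colored on either side.
\<close>

definition checkerboard_coloring :: "vlink \<Rightarrow> half_branch set \<Rightarrow> bool" where
  "checkerboard_coloring L K \<longleftrightarrow> K \<subseteq> half_branches L \<and>
     (\<forall>h h'. angle L h h' \<longrightarrow> (h' \<in> K \<longleftrightarrow> h \<notin> K)) \<and>
     (\<forall>h h'. arc L h h' \<longrightarrow> (h' \<in> K \<longleftrightarrow> h \<notin> K))"

definition checkerboard_colorable :: "vlink \<Rightarrow> bool" where
  "checkerboard_colorable L \<longleftrightarrow> (\<exists>K. checkerboard_coloring L K)"


section \<open>Signed ribbon graphs\<close>

text \<open>The ends of an edge \<open>e\<close> are \<open>(e, True)\<close> and \<open>(e, False)\<close>; \<open>vert\<close> gives the vertex of an
  edge-end, and \<open>rot\<close> the next edge-end in the (counterclockwise) cyclic order around that vertex.\<close>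

record ('v, 'e) ribbon_graph =
  verts :: "'v set"
  edges :: "'e set"
  vert :: "'e \<times> bool \<Rightarrow> 'v"
  rot :: "'e \<times> bool \<Rightarrow> 'e \<times> bool"

record ('v, 'e) signed_ribbon_graph = "('v, 'e) ribbon_graph" +
  sign :: "'e \<Rightarrow> int"

definition ends :: "('v, 'e, 'z) ribbon_graph_scheme \<Rightarrow> ('e \<times> bool) set" where
  "ends G = edges G \<times> UNIV"

definition ribbon_graph :: "('v, 'e, 'z) ribbon_graph_scheme \<Rightarrow> bool" where
  "ribbon_graph G \<longleftrightarrow>
     finite (verts G) \<and> finite (edges G) \<and> vert G ` ends G \<subseteq> verts G \<and>
     bij_betw (rot G) (ends G) (ends G) \<and>
     (\<forall>h\<in>ends G. \<forall>h'\<in>ends G. vert G h = vert G h' \<longleftrightarrow> (\<exists>n. (rot G ^^ n) h = h'))"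

definition signed_ribbon_graph :: "('v, 'e, 'z) signed_ribbon_graph_scheme \<Rightarrow> bool" where
  "signed_ribbon_graph G \<longleftrightarrow> ribbon_graph G \<and> sign G ` edges G \<subseteq> {1, -1}"

definition other_end :: "'e \<times> bool \<Rightarrow> 'e \<times> bool" where
  "other_end h = (fst h, \<not> snd h)"

text \<open>The cyclic orders of a spanning subgraph are obtained by skipping the deleted edge-ends.\<close>

definition spanning_subgraph ::
  "('v, 'e, 'z) ribbon_graph_scheme \<Rightarrow> 'e set \<Rightarrow> ('v, 'e, 'z) ribbon_graph_scheme" where
  "spanning_subgraph G F =
     G\<lparr>edges := F,
       rot := (\<lambda>h. (rot G ^^ (LEAST n. 0 < n \<and> (rot G ^^ n) h \<in> F \<times> UNIV)) h)\<rparr>"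

definition num_verts :: "('v, 'e, 'z) ribbon_graph_scheme \<Rightarrow> int" where
  "num_verts G = int (card (verts G))"

definition num_edges :: "('v, 'e, 'z) ribbon_graph_scheme \<Rightarrow> int" where
  "num_edges G = int (card (edges G))"

definition num_components :: "('v, 'e, 'z) ribbon_graph_scheme \<Rightarrow> int" where
  "num_components G =
     int (card (verts G //
       {(u, v). equivclp (\<lambda>a b. \<exists>e\<in>edges G. a = vert G (e, True) \<and> b = vert G (e, False)) u v}))"

definition graph_rank :: "('v, 'e, 'z) ribbon_graph_scheme \<Rightarrow> int" where
  "graph_rank G = num_verts G - num_components G"

definition nullity :: "('v, 'e, 'z) ribbon_graph_scheme \<Rightarrow> int" where
  "nullity G = num_edges G - graph_rank G"

text \<open>
  Components of the boundary of the oriented surface. The boundary of a vertex disc, traversed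
  counterclockwise, runs from the edge-end \<open>h\<close> to the edge-end \<open>rot G h\<close>; there it continues along the
  side of that ribbon to the other end of the ribbon, just after \<open>other_end (rot G h)\<close> in
  counterclockwise order. Each vertex without edge-ends contributes one more boundary circle.
\<close>

definition num_boundary :: "('v, 'e, 'z) ribbon_graph_scheme \<Rightarrow> int" where
  "num_boundary G =
     int (card (ends G //
       {(h, h'). equivclp (\<lambda>a b. a \<in> ends G \<and> b = other_end (rot G a)) h h'})) +
     int (card (verts G - vert G ` ends G))"

definition num_negative :: "('v, 'e, 'z) signed_ribbon_graph_scheme \<Rightarrow> int" where
  "num_negative G = int (card {e \<in> edges G. sign G e = -1})"

text \<open>Twice the half-integer \<open>s(F)\<close>.\<close>

definition twice_s :: "('v, 'e, 'z) signed_ribbon_graph_scheme \<Rightarrow> 'e set \<Rightarrow> int" where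
  "twice_s G F =
     num_negative (spanning_subgraph G F) - num_negative (spanning_subgraph G (edges G - F))"

text \<open>The signed Bollobas-Riordan polynomial \<open>R(x, y, z)\<close>, where \<open>q\<close> stands for the square root
  \<open>x^(1/2) / y^(1/2)\<close> of \<open>x / y\<close>, so that \<open>x^s(F) y^(-s(F)) = q^(2 s(F))\<close>.\<close>

definition signed_BR ::
  "('v, 'e, 'z) signed_ribbon_graph_scheme \<Rightarrow> 'a \<Rightarrow> 'a \<Rightarrow> 'a \<Rightarrow> 'a \<Rightarrow> 'a::field" where
  "signed_BR G x y q z =
     (\<Sum>F\<in>Pow (edges G). let H = spanning_subgraph G F in
        x powi (graph_rank G - graph_rank H) * y powi nullity H * q powi twice_s G F *
        z powi (num_components H - num_boundary H + nullity H))"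


section \<open>The signed ribbon graph of a checkerboard colorable diagram\<close>

text \<open>
  For an alternating diagram \<open>M\<close>, the vertex discs are in bijection with the exterior circles, i.e.
  the curves of the all-\<open>B\<close> state of \<open>M\<close>. The black angles at a crossing \<open>c\<close> are those whose clockwise
  sides are the two over half-branches \<open>(over M c, b)\<close>; these represent the two ends \<open>(c, b)\<close> of the
  edge \<open>c\<close>.

  The disc lies to the left of its counterclockwise boundary. Beyond the edge-end in the black
  angle with clockwise side \<open>h\<close>, the boundary therefore runs out along \<open>h\<close>, follows the arc to its
  other end \<open>h'\<close>, and there meets the edge-end in the black angle with counterclockwise side \<open>h'\<close>.
\<close>

definition black_side :: "vlink \<Rightarrow> complex \<times> bool \<Rightarrow> half_branch" where
  "black_side M h = (over M (fst h), snd h)"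

definition alternating_rot :: "vlink \<Rightarrow> complex \<times> bool \<Rightarrow> complex \<times> bool" where
  "alternating_rot M h =
     (THE g. fst g \<in> classical M \<and>
        (\<exists>h'. (arc M (black_side M h) h' \<or> arc M h' (black_side M h)) \<and>
              angle M (black_side M g) h'))"

definition alternating_ribbon_graph :: "vlink \<Rightarrow> (half_branch set + nat, complex) ribbon_graph" where
  "alternating_ribbon_graph M =
     \<lparr>verts = state_curves M {},
      edges = classical M,
      vert = (\<lambda>h. Inl (state_curve_rel M {} `` {black_side M h})),
      rot = alternating_rot M\<rparr>"

text \<open>\<open>X\<close> is a set of classical crossings whose switching makes \<open>L\<close> alternating.\<close>

definition diagram_ribbon_graph ::
  "vlink \<Rightarrow> complex set \<Rightarrow> (half_branch set + nat, complex) signed_ribbon_graph" where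
  "diagram_ribbon_graph L X =
     ribbon_graph.extend (alternating_ribbon_graph (switch X L))
       (signed_ribbon_graph.fields (\<lambda>c. if c \<in> X then -1 else 1))"

end

theory Submission
  imports Defs
begin

text \<open>
  In an alternating diagram every arc and every splitting joins an over half-branch to an under one,
  so a state curve is determined by the cyclic sequence of over half-branches, i.e. of edge-ends, on
  it. Stepping from one edge-end to the next is the vertex rotation, followed by \<open>other_end\<close> at the
  crossings with an \<open>A\<close>-splitting. Skipping the edge-ends outside the spanning subgraph of those
  crossings (a first-return map) turns this into the boundary walk of the subgraph, and the curves
  that never meet it are the isolated vertices; hence \<open>\<delta>\<close> is \<open>bc\<close>. For the original diagram the
  spanning subgraph \<open>F\<close> corresponds to the state \<open>S\<close> with \<open>F\<close> the symmetric difference of \<open>S\<close> and the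
  switched set, and the two sums agree term by term.
\<close>

section \<open>Quotients by generated equivalences\<close>

text \<open>Used to bound classes from above: points with different values under a map that is
  constant on generating pairs cannot be equivalent.\<close>

lemma equivclp_invariant:
  assumes "equivclp r a b" and "\<And>x y. r x y \<Longrightarrow> f x = f y"
  shows "f a = f b"
  using assms(1)
proof (induction rule: equivclp_induct)
  case (step y z)
  then show ?case using assms(2)[of y z] assms(2)[of z y] by auto
qed simp

abbreviation gen_equiv :: "('a \<Rightarrow> 'a \<Rightarrow> bool) \<Rightarrow> 'a rel" where
  "gen_equiv r \<equiv> {(x, y). equivclp r x y}"

lemma equiv_gen_equiv: "equiv UNIV (gen_equiv r)"
  by (auto intro!: equivI refl_onI symI transI intro: equivclp_sym equivclp_trans)

lemma gen_equiv_class_eq_iff: "gen_equiv r `` {x} = gen_equiv r `` {y} \<longleftrightarrow> equivclp r x y"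
  using eq_equiv_class_iff[OF equiv_gen_equiv, of x y r] by simp

lemma mem_class_gen_equiv:
  assumes "K \<in> Q // gen_equiv r" and "x \<in> K"
  shows "K = gen_equiv r `` {x}"
proof -
  obtain q where "K = gen_equiv r `` {q}"
    using assms(1) by (auto elim: quotientE)
  then show ?thesis
    using assms(2) gen_equiv_class_eq_iff[of r q x] by simp
qed

text \<open>\<open>r\<close> and \<open>s\<close> can differ only on pairs inside \<open>D\<close>.
  All points of an \<open>s\<close>-chain that have been reached so far are
  \<open>r\<close>-equivalent to \<open>x\<close>, hence outside \<open>D\<close>, so the next link
  of the chain is a link of \<open>r\<close> too.\<close>

lemma equivclp_avoiding:
  assumes eq: "\<And>x y. x \<notin> D \<or> y \<notin> D \<Longrightarrow> r x y \<longleftrightarrow> s x y"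
    and avoid: "\<And>z. equivclp r x z \<Longrightarrow> z \<notin> D"
  shows "equivclp s x y \<Longrightarrow> equivclp r x y"
proof (induction rule: equivclp_induct)
  case (step y z)
  then have "y \<notin> D" using avoid by blast
  with step eq have "r y z \<or> r z y" by blast
  with step show ?case by (meson equivclp_trans r_into_equivclp equivclp_sym)
qed simp

lemma quotient_avoiding_subset:
  assumes eq: "\<And>x y. x \<notin> D \<or> y \<notin> D \<Longrightarrow> r x y \<longleftrightarrow> s x y"
  shows "{K \<in> Q // gen_equiv r. K \<inter> D = {}} \<subseteq> {K \<in> Q // gen_equiv s. K \<inter> D = {}}"
proof
  fix K assume K: "K \<in> {K \<in> Q // gen_equiv r. K \<inter> D = {}}"
  then obtain q where q: "q \<in> Q" "K = gen_equiv r `` {q}"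
    by (auto elim: quotientE)
  have avoid: "z \<notin> D" if "equivclp r q z" for z
    using that K q(2) by auto
  have sr: "equivclp r q z" if "equivclp s q z" for z
    using equivclp_avoiding[OF eq avoid that] by blast
  \<comment> \<open>The converse needs the \<open>s\<close>-class of \<open>q\<close> to miss
    \<open>D\<close>, which follows from \<open>sr\<close> and \<open>avoid\<close>.\<close>
  then have "equivclp s q z \<longleftrightarrow> equivclp r q z" for z
    using equivclp_avoiding[of D s r q z] eq avoid by blast
  then have "K = gen_equiv s `` {q}"
    using q(2) by auto
  then show "K \<in> {K \<in> Q // gen_equiv s. K \<inter> D = {}}"
    using K quotientI[OF q(1), of "gen_equiv s"] by simp
qed

lemma quotient_avoiding_eq:
  assumes "\<And>x y. x \<notin> D \<or> y \<notin> D \<Longrightarrow> r x y \<longleftrightarrow> s x y"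
  shows "{K \<in> Q // gen_equiv r. K \<inter> D = {}} = {K \<in> Q // gen_equiv s. K \<inter> D = {}}"
  using quotient_avoiding_subset[of D r s Q] quotient_avoiding_subset[of D s r Q] assms by blast

text \<open>Sending \<open>g a\<close> to \<open>h a\<close> is well defined and injective because
  the kernels agree on \<open>F\<close>; \<open>inv_into F g\<close> chooses the
  representative.\<close>

lemma card_image_eq_if_same_kernel:
  assumes "\<And>a b. a \<in> F \<Longrightarrow> b \<in> F \<Longrightarrow> g a = g b \<longleftrightarrow> h a = h b"
  shows "card (g ` F) = card (h ` F)"
proof (rule bij_betw_same_card)
  let ?\<phi> = "\<lambda>y. h (inv_into F g y)"
  have "?\<phi> (g a) = h a" if "a \<in> F" for a
    using assms[of "inv_into F g (g a)" a] that
    by (metis f_inv_into_f image_eqI inv_into_into)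
  then show "bij_betw ?\<phi> (g ` F) (h ` F)"
    unfolding bij_betw_def inj_on_def using assms by (auto simp: image_image)
qed

text \<open>A class that meets the image of \<open>F\<close> is the class of some
  \<open>f a\<close>. With \<open>black_side\<close> as \<open>f\<close>, this counts the state
  curves through the crossings with an \<open>A\<close>-splitting.\<close>

lemma card_classes_meeting:
  assumes f: "f ` F \<subseteq> Q"
    and iff: "\<And>a b. a \<in> F \<Longrightarrow> b \<in> F \<Longrightarrow> equivclp r (f a) (f b) \<longleftrightarrow> equivclp s a b"
  shows "card {K \<in> Q // gen_equiv r. K \<inter> f ` F \<noteq> {}} = card (F // gen_equiv s)"
proof -
  have "{K \<in> Q // gen_equiv r. K \<inter> f ` F \<noteq> {}} = (\<lambda>a. gen_equiv r `` {f a}) ` F"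
  proof (intro equalityI subsetI)
    fix K assume "K \<in> {K \<in> Q // gen_equiv r. K \<inter> f ` F \<noteq> {}}"
    then show "K \<in> (\<lambda>a. gen_equiv r `` {f a}) ` F"
      using mem_class_gen_equiv by fastforce
  next
    fix K assume "K \<in> (\<lambda>a. gen_equiv r `` {f a}) ` F"
    then obtain a where "a \<in> F" "K = gen_equiv r `` {f a}" by blast
    with f show "K \<in> {K \<in> Q // gen_equiv r. K \<inter> f ` F \<noteq> {}}"
      using quotientI[of "f a" Q "gen_equiv r"] by fastforce
  qed
  moreover have "F // gen_equiv s = (\<lambda>a. gen_equiv s `` {a}) ` F"
    by (auto simp: quotient_def)
  ultimately show ?thesis
    using card_image_eq_if_same_kernel[of F "\<lambda>a. gen_equiv r `` {f a}" "\<lambda>a. gen_equiv s `` {a}"] iff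
    unfolding gen_equiv_class_eq_iff by simp
qed


section \<open>First returns\<close>

lemma funpow_in_carrier:
  assumes "\<And>x. x \<in> P \<Longrightarrow> \<rho> x \<in> P" and "a \<in> P"
  shows "(\<rho> ^^ n) a \<in> P"
  using assms by (induction n) auto

text \<open>By the pigeonhole principle two iterates agree, and injectivity cancels their common
  initial steps.\<close>

lemma inj_on_finite_recurrent:
  assumes "finite P" and maps: "\<And>x. x \<in> P \<Longrightarrow> \<rho> x \<in> P" and inj: "inj_on \<rho> P" and a: "a \<in> P"
  shows "\<exists>n>0. (\<rho> ^^ n) a = a"
proof -
  have "\<not> inj (\<lambda>n::nat. (\<rho> ^^ n) a)"
    using finite_subset[OF _ \<open>finite P\<close>, of "range (\<lambda>n. (\<rho> ^^ n) a)"]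
      funpow_in_carrier[of P \<rho>, OF maps a] finite_imageD infinite_UNIV_nat by blast
  then obtain i j :: nat where ij: "i < j" "(\<rho> ^^ i) a = (\<rho> ^^ j) a"
    unfolding inj_def by (metis linorder_neqE_nat)
  have cancel: "(\<rho> ^^ k) x = (\<rho> ^^ k) y \<Longrightarrow> x = y" if "x \<in> P" "y \<in> P" for x y k
    using that funpow_in_carrier[of P \<rho>, OF maps] inj by (induction k) (auto dest: inj_onD)
  have "(\<rho> ^^ i) ((\<rho> ^^ (j - i)) a) = (\<rho> ^^ i) a"
    using ij by (simp flip: funpow_add[unfolded o_def, THEN fun_cong])
  then have "(\<rho> ^^ (j - i)) a = a"
    using cancel a funpow_in_carrier[of P \<rho>, OF maps] by blast
  with ij show ?thesis by (intro exI[of _ "j - i"]) simp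
qed

text \<open>For the set \<open>F \<times> UNIV\<close> of edge-ends this is the rotation of a
  spanning subgraph. If the orbit never enters the set, \<open>LEAST\<close> is unspecified; the
  predicate \<open>returns\<close> excludes that case.\<close>

definition first_return :: "'a set \<Rightarrow> ('a \<Rightarrow> 'a) \<Rightarrow> 'a \<Rightarrow> 'a" where
  "first_return F \<rho> a = (\<rho> ^^ (LEAST n. 0 < n \<and> (\<rho> ^^ n) a \<in> F)) a"

definition returns :: "'a set \<Rightarrow> ('a \<Rightarrow> 'a) \<Rightarrow> 'a \<Rightarrow> bool" where
  "returns F \<rho> a \<longleftrightarrow> (\<exists>n>0. (\<rho> ^^ n) a \<in> F)"

lemma first_return_hit: "\<rho> a \<in> F \<Longrightarrow> first_return F \<rho> a = \<rho> a"
  unfolding first_return_def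
  by (subst Least_equality[where x = 1]) auto

lemma returns_step:
  assumes "\<rho> a \<notin> F"
  shows "returns F \<rho> (\<rho> a) \<longleftrightarrow> returns F \<rho> a"
proof
  assume "returns F \<rho> (\<rho> a)"
  then obtain n where "n > 0" "(\<rho> ^^ n) (\<rho> a) \<in> F" unfolding returns_def by blast
  then show "returns F \<rho> a" unfolding returns_def
    by (intro exI[of _ "Suc n"]) (simp add: funpow_swap1)
next
  assume "returns F \<rho> a"
  then obtain n where n: "n > 0" "(\<rho> ^^ n) a \<in> F" unfolding returns_def by blast
  then obtain m where m: "n = Suc m" by (cases n) auto
  \<comment> \<open>\<open>n\<close> is not 1, since \<open>\<rho> a\<close> lies outside
    \<open>F\<close>.\<close>
  with n assms have "m > 0" by (cases m) auto
  with n m show "returns F \<rho> (\<rho> a)" unfolding returns_def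
    by (intro exI[of _ m]) (simp add: funpow_swap1)
qed

lemma first_return_step:
  assumes "\<rho> a \<notin> F" and "returns F \<rho> a"
  shows "first_return F \<rho> (\<rho> a) = first_return F \<rho> a"
proof -
  let ?P = "\<lambda>n. 0 < n \<and> (\<rho> ^^ n) a \<in> F"
  obtain n where n: "?P n" using assms(2) unfolding returns_def by blast
  have "(LEAST n. ?P n) = Suc (LEAST m. ?P (Suc m))"
    using n by (intro Least_Suc) auto
  moreover have "?P (Suc m) \<longleftrightarrow> 0 < m \<and> (\<rho> ^^ m) (\<rho> a) \<in> F" for m
    using assms(1) by (cases "m = 0") (auto simp: funpow_swap1)
  ultimately show ?thesis
    unfolding first_return_def by (simp add: funpow_swap1)
qed

text \<open>The walk \<open>r\<close> makes single steps of \<open>\<rho>\<close> and applies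
  \<open>\<tau>\<close> only on landing in \<open>F\<close>; between two visits to \<open>F\<close>
  it therefore performs exactly one first return followed by \<open>\<tau>\<close>, which is a step
  of \<open>s\<close>.\<close>

lemma first_return_equivclp:
  fixes \<tau> \<rho> :: "'a \<Rightarrow> 'a"
  assumes "finite P" and maps: "\<And>x. x \<in> P \<Longrightarrow> \<rho> x \<in> P" and inj: "inj_on \<rho> P"
    and "F \<subseteq> P" and \<tau>: "\<And>x. x \<in> F \<Longrightarrow> \<tau> x \<in> F" and ab: "a \<in> F" "b \<in> F"
  defines "r \<equiv> \<lambda>x y. x \<in> P \<and> y = (if \<rho> x \<in> F then \<tau> (\<rho> x) else \<rho> x)"
    and "s \<equiv> \<lambda>x y. x \<in> F \<and> y = \<tau> (first_return F \<rho> x)"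
  shows "equivclp r a b \<longleftrightarrow> equivclp s a b"
proof
  have ret: "returns F \<rho> x" if "x \<in> F" for x
    using inj_on_finite_recurrent[OF \<open>finite P\<close> maps inj, of x] that \<open>F \<subseteq> P\<close>
    unfolding returns_def by (metis subsetD)
  \<comment> \<open>\<open>n\<close> is any hitting time, not just the least one, and
    \<open>x\<close> may lie outside \<open>F\<close>; this lets the induction pass from
    \<open>x\<close> to \<open>\<rho> x\<close>.\<close>
  have seg: "equivclp r x (\<tau> (first_return F \<rho> x))" if "n > 0" "(\<rho> ^^ n) x \<in> F" "x \<in> P" for x n
    using that
  proof (induction n arbitrary: x)
    case (Suc n)
    show ?case
    proof (cases "\<rho> x \<in> F")
      case True
      then have "r x (\<tau> (first_return F \<rho> x))"
        using Suc.prems by (simp add: r_def first_return_hit)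
      then show ?thesis by blast
    next
      case False
      have "returns F \<rho> x" using Suc.prems unfolding returns_def by blast
      then have fr: "first_return F \<rho> (\<rho> x) = first_return F \<rho> x"
        using False first_return_step by metis
      have "n > 0" using False Suc.prems by (cases n) auto
      then have "equivclp r (\<rho> x) (\<tau> (first_return F \<rho> (\<rho> x)))"
        using Suc.prems maps by (intro Suc.IH) (auto simp: funpow_swap1)
      moreover have "r x (\<rho> x)"
        using False Suc.prems by (simp add: r_def)
      ultimately show ?thesis
        unfolding fr by (meson equivclp_trans r_into_equivclp)
    qed
  qed simp
  have step: "equivclp r x y" if "s x y" for x y
    using that seg ret[of x] \<open>F \<subseteq> P\<close> unfolding s_def returns_def by blast
  show "equivclp r a b" if "equivclp s a b"
    using that
  proof (induction rule: equivclp_induct)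
    case (step y z)
    then show ?case
      using \<open>\<And>x y. s x y \<Longrightarrow> equivclp r x y\<close> by (meson equivclp_trans equivclp_sym)
  qed simp
  \<comment> \<open>The invariant of the walk \<open>r\<close>: a point gets the
    \<open>s\<close>-class in which its walk next lands, or the empty set if it never reaches
    \<open>F\<close>.\<close>
  define g where "g x = (if x \<in> F then {c. equivclp s x c}
      else {c. returns F \<rho> x \<and> equivclp s (\<tau> (first_return F \<rho> x)) c})" for x
  have cls: "{c. equivclp s x c} = {c. equivclp s y c}" if "equivclp s x y" for x y
    using that by (intro Collect_cong iffI) (meson equivclp_trans equivclp_sym)+
  \<comment> \<open>On \<open>F\<close> the two clauses of \<open>g\<close> agree, because
    \<open>x\<close> is \<open>s\<close>-related to
    \<open>\<tau> (first_return F \<rho> x)\<close>.\<close>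
  have g': "g x = {c. returns F \<rho> x \<and> equivclp s (\<tau> (first_return F \<rho> x)) c}" for x
  proof (cases "x \<in> F")
    case True
    then have "equivclp s x (\<tau> (first_return F \<rho> x))"
      by (intro r_into_equivclp) (simp add: s_def)
    from cls[OF this] show ?thesis
      using True ret by (simp add: g_def)
  qed (simp add: g_def)
  have "g x = g y" if "r x y" for x y
  proof (cases "\<rho> x \<in> F")
    case True
    then have "returns F \<rho> x" unfolding returns_def by (intro exI[of _ 1]) simp
    moreover have "y = \<tau> (\<rho> x)" "y \<in> F"
      using True that \<tau> by (auto simp: r_def)
    ultimately show ?thesis
      using True by (simp add: g'[of x] g_def[of "\<tau> (\<rho> x)"] first_return_hit)
  next
    case False
    then have "y = \<rho> x" using that by (simp add: r_def)
    then show ?thesis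
      using False returns_step[of \<rho> x F] first_return_step[of \<rho> x F] by (auto simp: g'[of x] g'[of "\<rho> x"])
  qed
  then have "g a = g b" if "equivclp r a b"
    using equivclp_invariant[OF that, of g] by blast
  then show "equivclp s a b" if "equivclp r a b"
    using that ab unfolding g_def by (auto simp: set_eq_iff)
qed


section \<open>Half-branches at the classical crossings\<close>

definition opposite_point :: "vlink \<Rightarrow> cpoint \<Rightarrow> cpoint" where
  "opposite_point L p = (THE q. q \<in> preimages L (pos L p) \<and> q \<noteq> p)"

text \<open>The next half-branch counterclockwise lies on the other strand. The sign of
  \<open>cross2\<close> tells whether it is the outgoing half; starting from an incoming half-branch
  negates the outward vector and so flips the answer.\<close>

definition quarter_turn :: "vlink \<Rightarrow> half_branch \<Rightarrow> half_branch" where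
  "quarter_turn L h = (opposite_point L (fst h),
     snd h \<longleftrightarrow> 0 < cross2 (velocity L (fst h)) (velocity L (opposite_point L (fst h))))"

definition arc_partner :: "vlink \<Rightarrow> half_branch \<Rightarrow> half_branch" where
  "arc_partner L h =
     (if snd h then (next_point L (fst h), False)
      else (inv_into (classical_points L) (next_point L) (fst h), True))"

lemma cross2_same: "cross2 u u = 0"
  by (simp add: cross2_def)

lemma cross2_swap: "cross2 u w = - cross2 w u"
  by (simp add: cross2_def)

lemma cross2_minus: "cross2 (- u) w = - cross2 u w" "cross2 u (- w) = - cross2 u w"
  by (simp_all add: cross2_def)

locale link_diagram =
  fixes L :: vlink
  assumes diagram: "virtual_link_diagram L"
begin

section \<open>Finiteness and the preimages of classical crossings\<close>

lemma double_pointsD: "c \<in> classical L \<Longrightarrow> c \<in> double_points L"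
  using diagram by (auto simp: virtual_link_diagram_def)

lemma finite_classical: "finite (classical L)"
proof (rule finite_subset)
  show "classical L \<subseteq> double_points L" using double_pointsD by blast
  show "finite (double_points L)"
    using diagram unfolding virtual_link_diagram_def generic_immersion_def by blast
qed

lemma card_preimages: "c \<in> classical L \<Longrightarrow> card (preimages L c) = 2"
  using diagram double_pointsD unfolding virtual_link_diagram_def generic_immersion_def by blast

lemma finite_classical_points: "finite (classical_points L)"
proof (rule finite_subset)
  show "classical_points L \<subseteq> (\<Union>c\<in>classical L. preimages L c)"
    by (auto simp: classical_points_def preimages_def)
  show "finite (\<Union>c\<in>classical L. preimages L c)"
    using finite_classical card_preimages by (intro finite_UN_I) (metis card_ge_0_finite zero_less_numeral)+
qed

lemma finite_half_branches: "finite (half_branches L)"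
  using finite_classical_points by (simp add: half_branches_def)

lemma mem_preimages_classical:
  "c \<in> classical L \<Longrightarrow> p \<in> preimages L c \<longleftrightarrow> p \<in> classical_points L \<and> pos L p = c"
  by (auto simp: classical_points_def preimages_def)

lemma pos_classical: "p \<in> classical_points L \<Longrightarrow> pos L p \<in> classical L"
  by (simp add: classical_points_def)

lemma over_classical:
  assumes "c \<in> classical L"
  shows "over L c \<in> classical_points L" "pos L (over L c) = c"
proof -
  have "over L c \<in> preimages L c"
    using assms diagram unfolding virtual_link_diagram_def by blast
  then show "over L c \<in> classical_points L" "pos L (over L c) = c"
    using mem_preimages_classical[OF assms, of "over L c"] by blast+
qed

section \<open>The two strands at a crossing\<close>

lemma opposite_point_unique:
  assumes p: "p \<in> classical_points L"
  shows "q \<in> preimages L (pos L p) \<and> q \<noteq> p \<longleftrightarrow> q = opposite_point L p"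
proof -
  let ?Q = "\<lambda>q. q \<in> preimages L (pos L p) \<and> q \<noteq> p"
  have "p \<in> preimages L (pos L p)"
    using p mem_preimages_classical[OF pos_classical[OF p]] by simp
  then have ex1: "\<exists>!q. ?Q q"
    using card_preimages[OF pos_classical[OF p]] unfolding card_2_iff' by metis
  then have "?Q (opposite_point L p)"
    unfolding opposite_point_def by (rule theI')
  with ex1 show ?thesis by metis
qed

lemma opposite_point:
  assumes p: "p \<in> classical_points L"
  shows "opposite_point L p \<in> classical_points L" "pos L (opposite_point L p) = pos L p"
    "opposite_point L p \<noteq> p" "opposite_point L (opposite_point L p) = p"
proof -
  have *: "opposite_point L p \<in> preimages L (pos L p)" "opposite_point L p \<noteq> p"
    using opposite_point_unique[OF p, of "opposite_point L p"] by simp_all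
  then show o: "opposite_point L p \<in> classical_points L" "pos L (opposite_point L p) = pos L p"
    "opposite_point L p \<noteq> p"
    using mem_preimages_classical[OF pos_classical[OF p], of "opposite_point L p"] by blast+
  have "p \<in> preimages L (pos L p)"
    using p mem_preimages_classical[OF pos_classical[OF p]] by simp
  then show "opposite_point L (opposite_point L p) = p"
    using opposite_point_unique[OF o(1), of p] o(2,3) by metis
qed

lemma same_pos_cases:
  assumes "p \<in> classical_points L" "q \<in> classical_points L"
  shows "pos L q = pos L p \<longleftrightarrow> q = p \<or> q = opposite_point L p"
  using assms opposite_point_unique[of p q] opposite_point(2)[of p]
    mem_preimages_classical[OF pos_classical, of p q] by metis

lemma cross2_opposite_nonzero:
  assumes p: "p \<in> classical_points L"
  shows "cross2 (velocity L p) (velocity L (opposite_point L p)) \<noteq> 0"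
proof -
  have "p \<in> points L" "opposite_point L p \<in> points L"
    using p opposite_point(1)[OF p] by (simp_all add: classical_points_def)
  moreover have "\<forall>p\<in>points L. \<forall>q\<in>points L.
      p \<noteq> q \<and> pos L p = pos L q \<longrightarrow> cross2 (velocity L p) (velocity L q) \<noteq> 0"
    using diagram unfolding virtual_link_diagram_def generic_immersion_def by blast
  ultimately show ?thesis
    using opposite_point(2,3)[OF p] by metis
qed

lemma is_over_opposite:
  assumes p: "p \<in> classical_points L"
  shows "is_over L (opposite_point L p) \<longleftrightarrow> \<not> is_over L p"
proof -
  have "over L (pos L p) = p \<or> over L (pos L p) = opposite_point L p"
    using same_pos_cases[OF p over_classical(1)[OF pos_classical[OF p]]]
      over_classical(2)[OF pos_classical[OF p]] by blast
  then show ?thesis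
    unfolding is_over_def opposite_point(2)[OF p] using opposite_point(3)[OF p] by metis
qed

section \<open>Rotation of the half-branches around a crossing\<close>

lemma quarter_turn:
  assumes h: "h \<in> half_branches L"
  shows "quarter_turn L h \<in> half_branches L"
    "pos L (fst (quarter_turn L h)) = pos L (fst h)"
    "is_over L (fst (quarter_turn L h)) \<longleftrightarrow> \<not> is_over L (fst h)"
    "quarter_turn L (quarter_turn L h) = (fst h, \<not> snd h)"
proof -
  have p: "fst h \<in> classical_points L" using h by (auto simp: half_branches_def)
  show "quarter_turn L h \<in> half_branches L" "pos L (fst (quarter_turn L h)) = pos L (fst h)"
    "is_over L (fst (quarter_turn L h)) \<longleftrightarrow> \<not> is_over L (fst h)"
    using opposite_point[OF p] is_over_opposite[OF p]
    by (auto simp: quarter_turn_def half_branches_def)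
  \<comment> \<open>The second turn compares the same velocities in the other order. By
    transversality the sign is nonzero, so it is reversed and the direction flips.\<close>
  show "quarter_turn L (quarter_turn L h) = (fst h, \<not> snd h)"
    using opposite_point[OF p] cross2_opposite_nonzero[OF p]
      cross2_swap[of "velocity L (opposite_point L (fst h))" "velocity L (fst h)"]
    by (auto simp: quarter_turn_def)
qed

lemma quarter_turn_4:
  assumes h: "h \<in> half_branches L"
  shows "quarter_turn L (quarter_turn L (quarter_turn L (quarter_turn L h))) = h"
  using quarter_turn[OF h] quarter_turn(4)[of "(fst h, \<not> snd h)"] h
  by (simp add: half_branches_def mem_Times_iff)

text \<open>Three quarter turns are the inverse quarter turn, i.e. one step clockwise.\<close>

lemma quarter_turn_3:
  assumes h: "h \<in> half_branches L"
  defines "k \<equiv> quarter_turn L (quarter_turn L (quarter_turn L h))"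
  shows "k \<in> half_branches L" "is_over L (fst k) \<longleftrightarrow> \<not> is_over L (fst h)"
    "pos L (fst k) = pos L (fst h)" "quarter_turn L k = h"
proof -
  note h1 = quarter_turn(1)[OF h]
  note h2 = quarter_turn(1)[OF h1]
  show "k \<in> half_branches L" unfolding k_def by (rule quarter_turn(1)[OF h2])
  show "is_over L (fst k) \<longleftrightarrow> \<not> is_over L (fst h)"
    unfolding k_def quarter_turn(3)[OF h2] quarter_turn(3)[OF h1] quarter_turn(3)[OF h] by simp
  show "pos L (fst k) = pos L (fst h)"
    unfolding k_def quarter_turn(2)[OF h2] quarter_turn(2)[OF h1] quarter_turn(2)[OF h] ..
  show "quarter_turn L k = h"
    unfolding k_def by (rule quarter_turn_4[OF h])
qed

text \<open>Half-branches of the same strand are collinear and have \<open>cross2\<close> equal to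
  0; of the two on the other strand, exactly one lies on the counterclockwise side.\<close>

lemma angle_iff:
  assumes h: "h \<in> half_branches L"
  shows "angle L h h' \<longleftrightarrow> h' = quarter_turn L h"
proof -
  have p: "fst h \<in> classical_points L" using h by (auto simp: half_branches_def)
  define u w where "u = velocity L (fst h)" and "w = velocity L (opposite_point L (fst h))"
  have nz: "cross2 u w \<noteq> 0" using cross2_opposite_nonzero[OF p] by (simp add: u_def w_def)
  have "angle L h h' \<longleftrightarrow> fst h' \<in> classical_points L \<and> pos L (fst h') = pos L (fst h) \<and>
      0 < cross2 (outward L h) (outward L h')"
    using h by (cases h') (auto simp: angle_def half_branches_def)
  also have "\<dots> \<longleftrightarrow> (fst h' = fst h \<or> fst h' = opposite_point L (fst h)) \<and>
      0 < cross2 (outward L h) (outward L h')"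
    using same_pos_cases[OF p] opposite_point(1)[OF p] p by metis
  also have "\<dots> \<longleftrightarrow> fst h' = opposite_point L (fst h) \<and> (snd h' \<longleftrightarrow> snd h \<longleftrightarrow> 0 < cross2 u w)"
    using nz by (auto simp: outward_def cross2_minus cross2_same u_def w_def split: if_splits)
  also have "\<dots> \<longleftrightarrow> h' = quarter_turn L h"
    by (auto simp: quarter_turn_def u_def w_def prod_eq_iff)
  finally show ?thesis .
qed

section \<open>Arcs between consecutive passages\<close>

lemma next_point_in: "p \<in> classical_points L \<Longrightarrow> next_point L p \<in> classical_points L"
proof -
  assume p: "p \<in> classical_points L"
  let ?T = "{t. (fst p, t) \<in> classical_points L}"
  let ?T' = "{t \<in> ?T. snd p < t}"
  have fin: "finite ?T"
    using finite_classical_points by (rule finite_imageI[of _ snd, THEN finite_subset[rotated]]) force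
  have "snd p \<in> ?T" using p by simp
  then have "Min ?T \<in> ?T" using fin Min_in by blast
  moreover have "Min ?T' \<in> ?T'" if "?T' \<noteq> {}" using fin that by (intro Min_in) auto
  ultimately show "next_point L p \<in> classical_points L"
    unfolding next_point_def Let_def by auto
qed

lemma next_point_surj:
  assumes q: "q \<in> classical_points L"
  shows "\<exists>p\<in>classical_points L. next_point L p = q"
proof -
  let ?T = "{t. (fst q, t) \<in> classical_points L}"
  have fin: "finite ?T"
    using finite_classical_points by (rule finite_imageI[of _ snd, THEN finite_subset[rotated]]) force
  have qT: "snd q \<in> ?T" using q by simp
  show ?thesis
  proof (cases "{t \<in> ?T. t < snd q} = {}")
    case True
    \<comment> \<open>\<open>q\<close> is the first passage of its component, so its predecessor is
      the last one, where \<open>next_point\<close> wraps around. This includes a component with a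
      single passage.\<close>
    have M: "Max ?T \<in> ?T" using fin qT Max_in by blast
    have "{t \<in> ?T. Max ?T < t} = {}" using fin by (auto simp: not_less)
    moreover have "Min ?T = snd q"
      using True qT fin by (intro Min_eqI) (auto simp: not_less)
    ultimately have "next_point L (fst q, Max ?T) = q"
      unfolding next_point_def Let_def by simp
    then show ?thesis using M by blast
  next
    case False
    let ?s = "Max {t \<in> ?T. t < snd q}"
    have s: "?s \<in> {t \<in> ?T. t < snd q}" using fin False by (intro Max_in) auto
    \<comment> \<open>No passage lies strictly between \<open>?s\<close> and
      \<open>q\<close>.\<close>
    have "t \<ge> snd q" if "t \<in> ?T" "?s < t" for t
    proof (rule ccontr)
      assume "\<not> t \<ge> snd q"
      then have "t \<le> ?s" using fin that by (intro Max_ge) auto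
      with that show False by simp
    qed
    then have "Min {t \<in> ?T. ?s < t} = snd q"
      using s qT fin by (intro Min_eqI) auto
    moreover have "{t \<in> ?T. ?s < t} \<noteq> {}" using s qT by blast
    ultimately have "next_point L (fst q, ?s) = q"
      unfolding next_point_def Let_def by simp
    then show ?thesis using s by blast
  qed
qed

text \<open>A surjection of a finite set onto itself is injective.\<close>

lemma next_point_bij: "bij_betw (next_point L) (classical_points L) (classical_points L)"
  unfolding bij_betw_def
proof
  show im: "next_point L ` classical_points L = classical_points L"
    using next_point_in next_point_surj by (auto simp: image_iff) metis
  then show "inj_on (next_point L) (classical_points L)"
    using finite_classical_points by (simp add: eq_card_imp_inj_on)
qed

lemma arc_partner:
  assumes h: "h \<in> half_branches L"
  shows "arc_partner L h \<in> half_branches L"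
    "arc_partner L (arc_partner L h) = h"
    "arc L h h' \<or> arc L h' h \<longleftrightarrow> h' = arc_partner L h"
proof -
  let ?n = "next_point L" and ?C = "classical_points L"
  obtain p b where hp: "h = (p, b)" "p \<in> ?C"
    using h by (auto simp: half_branches_def)
  have inv: "inv_into ?C ?n p \<in> ?C" "?n (inv_into ?C ?n p) = p" "inv_into ?C ?n (?n p) = p"
    using bij_betw_inv_into_right[OF next_point_bij hp(2)]
      bij_betw_inv_into_left[OF next_point_bij hp(2)]
      bij_betw_apply[OF bij_betw_inv_into[OF next_point_bij] hp(2)] by blast+
  show "arc_partner L h \<in> half_branches L" "arc_partner L (arc_partner L h) = h"
    using inv hp next_point_in by (auto simp: arc_partner_def half_branches_def)
  show "arc L h h' \<or> arc L h' h \<longleftrightarrow> h' = arc_partner L h"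
  proof (cases b)
    case False
    have "p = ?n x \<longleftrightarrow> x = inv_into ?C ?n p" if "x \<in> ?C" for x
      using that inv next_point_bij bij_betw_inv_into_left by metis
    then show ?thesis
      using False hp inv by (auto simp: arc_def arc_partner_def)
  qed (use hp in \<open>auto simp: arc_def arc_partner_def\<close>)
qed

lemma half_branch_invariant:
  assumes "equivclp (\<lambda>a b. arc L a b \<or> split_join L S a b) h h'" "h \<in> half_branches L"
  shows "h' \<in> half_branches L"
proof -
  have "(h \<in> half_branches L) = (h' \<in> half_branches L)"
  proof (rule equivclp_invariant[OF assms(1)])
    fix x y assume "arc L x y \<or> split_join L S x y"
    then show "(x \<in> half_branches L) = (y \<in> half_branches L)"
      by (auto simp: arc_def split_join_def angle_def half_branches_def next_point_in)
  qed
  with assms(2) show ?thesis by simp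
qed

lemma split_join_iff:
  assumes "h \<in> half_branches L"
  shows "split_join L S h h' \<longleftrightarrow> h' = quarter_turn L h \<and>
    (if pos L (fst h) \<in> S then \<not> is_over L (fst h) else is_over L (fst h))"
  using angle_iff[OF assms] by (auto simp: split_join_def)

end


section \<open>State curves as boundary components\<close>

locale alternating_diagram = link_diagram +
  assumes alt: "alternating L"
begin

abbreviation (input) edge_ends :: "(complex \<times> bool) set" where
  "edge_ends \<equiv> classical L \<times> UNIV"

abbreviation joined :: "complex set \<Rightarrow> half_branch \<Rightarrow> half_branch \<Rightarrow> bool" where
  "joined S \<equiv> \<lambda>a b. arc L a b \<or> split_join L S a b"

lemma joinedI:
  assumes "arc L x y \<or> arc L y x \<or> split_join L S x y \<or> split_join L S y x"
  shows "equivclp (joined S) x y"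
proof -
  have "joined S x y \<or> joined S y x" using assms by blast
  then show ?thesis
    by (elim disjE[of "joined S x y" "joined S y x"])
      (rule r_into_equivclp, simp, rule equivclp_sym, rule r_into_equivclp, simp)
qed

text \<open>Inverse to \<open>black_side\<close> on over half-branches, each of which is the
  clockwise side of one black angle.\<close>

definition end_of :: "half_branch \<Rightarrow> complex \<times> bool" where
  "end_of h = (pos L (fst h), snd h)"

text \<open>This is how alternation enters: the two ends of an arc are consecutive passages.\<close>

lemma is_over_arc_partner:
  assumes h: "h \<in> half_branches L"
  shows "is_over L (fst (arc_partner L h)) \<longleftrightarrow> \<not> is_over L (fst h)"
proof -
  have "arc L h (arc_partner L h) \<or> arc L (arc_partner L h) h"
    using arc_partner(3)[OF h] by blast
  then show ?thesis
    using alt by (auto simp: arc_def alternating_def)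
qed

lemma black_side_end_of:
  "is_over L (fst h) \<Longrightarrow> black_side L (end_of h) = h"
  by (simp add: black_side_def end_of_def is_over_def)

lemma end_of_in: "h \<in> half_branches L \<Longrightarrow> end_of h \<in> edge_ends"
  by (auto simp: end_of_def half_branches_def pos_classical)

lemma black_side:
  assumes "e \<in> edge_ends"
  shows "black_side L e \<in> half_branches L" "is_over L (fst (black_side L e))"
    "pos L (fst (black_side L e)) = fst e" "end_of (black_side L e) = e"
  using assms over_classical[of "fst e"]
  by (auto simp: black_side_def half_branches_def is_over_def end_of_def)

text \<open>A half turn reverses direction along the over strand, which exchanges the two ends of
  the edge.\<close>

lemma quarter_turn_black_side:
  assumes "e \<in> edge_ends"
  shows "quarter_turn L (quarter_turn L (black_side L e)) = black_side L (other_end e)"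
  using quarter_turn(4)[OF black_side(1)[OF assms]] by (simp add: black_side_def other_end_def)

lemma quarter_turn_inj:
  assumes "h \<in> half_branches L" "h' \<in> half_branches L" "quarter_turn L h = quarter_turn L h'"
  shows "h = h'"
  using quarter_turn_4[OF assms(1)] quarter_turn_4[OF assms(2)] assms(3) by metis

text \<open>By alternation the arc from a black side ends in an under half-branch. Its clockwise
  neighbour is then over, hence the black side of an edge-end, and invertibility of the quarter turn
  makes that edge-end unique.\<close>

lemma alternating_rot_unique:
  assumes e: "e \<in> edge_ends"
  shows "g \<in> edge_ends \<and> quarter_turn L (black_side L g) = arc_partner L (black_side L e) \<longleftrightarrow>
    g = alternating_rot L e"
proof -
  let ?u = "arc_partner L (black_side L e)"
  let ?Q = "\<lambda>g. g \<in> edge_ends \<and> quarter_turn L (black_side L g) = ?u"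
  have u: "?u \<in> half_branches L" "\<not> is_over L (fst ?u)"
    using arc_partner(1)[OF black_side(1)[OF e]] is_over_arc_partner[OF black_side(1)[OF e]]
      black_side(2)[OF e] by simp_all
  obtain h where h: "h \<in> half_branches L" "is_over L (fst h)" "quarter_turn L h = ?u"
    using that[OF quarter_turn_3(1)[OF u(1)] _ quarter_turn_3(4)[OF u(1)]] quarter_turn_3(2)[OF u(1)] u(2)
    by blast
  have Q: "?Q (end_of h)"
    unfolding black_side_end_of[OF h(2)] h(3) using end_of_in[OF h(1)] by simp
  have unique: "g = g'" if "?Q g" "?Q g'" for g g'
  proof -
    have "black_side L g = black_side L g'"
      by (rule quarter_turn_inj[OF black_side(1) black_side(1)]) (use that in simp_all)
    then show ?thesis using that black_side(4) by metis
  qed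
  have ex1: "\<exists>!g. ?Q g"
    using Q by (rule ex1I) (rule unique[OF _ Q])
  have "(\<exists>h'. (arc L (black_side L e) h' \<or> arc L h' (black_side L e)) \<and>
      angle L (black_side L g) h') \<longleftrightarrow> angle L (black_side L g) ?u" for g
    using arc_partner(3)[OF black_side(1)[OF e]] by simp
  moreover have "fst g \<in> classical L \<and> angle L (black_side L g) ?u \<longleftrightarrow> ?Q g" for g
    using angle_iff[OF black_side(1)[of g], of ?u] by (cases "fst g \<in> classical L") (auto simp: mem_Times_iff)
  ultimately have "fst g \<in> classical L \<and>
      (\<exists>h'. (arc L (black_side L e) h' \<or> arc L h' (black_side L e)) \<and> angle L (black_side L g) h')
      \<longleftrightarrow> ?Q g" for g
    by simp
  then have "alternating_rot L e = (THE g. ?Q g)"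
    unfolding alternating_rot_def by simp
  then have "?Q (alternating_rot L e)"
    using theI'[OF ex1] by simp
  then show ?thesis using unique by metis
qed

lemma alternating_rot:
  assumes e: "e \<in> edge_ends"
  shows "alternating_rot L e \<in> edge_ends"
    "quarter_turn L (black_side L (alternating_rot L e)) = arc_partner L (black_side L e)"
  using alternating_rot_unique[OF e, of "alternating_rot L e"] by simp_all

lemma inj_on_alternating_rot: "inj_on (alternating_rot L) edge_ends"
proof (rule inj_onI)
  fix e e' assume e: "e \<in> edge_ends" "e' \<in> edge_ends" "alternating_rot L e = alternating_rot L e'"
  then have "arc_partner L (black_side L e) = arc_partner L (black_side L e')"
    using alternating_rot(2) by metis
  then have "black_side L e = black_side L e'"
    using arc_partner(2) black_side(1) e by metis
  then show "e = e'"
    using black_side(4) e by metis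
qed

text \<open>The next black side met along a curve of the state \<open>S\<close>; an
  \<open>A\<close>-splitting sends the curve to the other end of the edge.\<close>

definition next_black :: "complex set \<Rightarrow> complex \<times> bool \<Rightarrow> complex \<times> bool \<Rightarrow> bool" where
  "next_black S x y \<longleftrightarrow> x \<in> edge_ends \<and>
     y = (if alternating_rot L x \<in> S \<times> UNIV then other_end (alternating_rot L x)
          else alternating_rot L x)"

text \<open>Along a state curve, over and under half-branches alternate. From a black side one runs
  along the arc to an under half-branch and then through the splitting to the next black side.\<close>

lemma joined_next_black:
  assumes "next_black S e e'"
  shows "equivclp (joined S) (black_side L e) (black_side L e')"
proof -
  let ?r = "alternating_rot L e" and ?u = "arc_partner L (black_side L e)"
  have e: "e \<in> edge_ends" using assms by (simp add: next_black_def)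
  note r = alternating_rot[OF e]
  have u: "?u \<in> half_branches L" "\<not> is_over L (fst ?u)" "pos L (fst ?u) = fst ?r"
    using arc_partner(1)[OF black_side(1)[OF e]] is_over_arc_partner[OF black_side(1)[OF e]]
      black_side(2)[OF e] quarter_turn(2)[OF black_side(1)[OF r(1)]] black_side(3)[OF r(1)] r(2)
    by auto
  have 1: "equivclp (joined S) (black_side L e) ?u"
    using arc_partner(3)[OF black_side(1)[OF e], of ?u] by (intro joinedI) blast
  \<comment> \<open>\<open>?u\<close> follows the black side of \<open>?r\<close> counterclockwise.
    The \<open>B\<close>-splitting joins these two; the \<open>A\<close>-splitting joins
    \<open>?u\<close> to its own successor, a half turn from that black side.\<close>
  have 2: "equivclp (joined S) ?u (black_side L e')"
  proof (cases "fst ?r \<in> S")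
    case True
    then have "e' = other_end ?r" using assms by (simp add: next_black_def mem_Times_iff)
    then have "quarter_turn L ?u = black_side L e'"
      using quarter_turn_black_side[OF r(1)] r(2) by simp
    then show ?thesis
      using True u split_join_iff[OF u(1)] by (intro joinedI) simp
  next
    case False
    then have "e' = ?r" using assms by (simp add: next_black_def mem_Times_iff)
    then show ?thesis
      using False r split_join_iff[OF black_side(1)[OF r(1)], of S ?u] black_side[OF r(1)]
      by (intro joinedI) simp
  qed
  show ?thesis by (rule equivclp_trans[OF 1 2])
qed

text \<open>For the direction from curves to the walk, each half-branch is assigned the walk class
  of the over half-branch on its arc, and this class is invariant under arcs and splittings.\<close>

lemma equivclp_black_side_iff:
  assumes ab: "a \<in> edge_ends" "b \<in> edge_ends"
  shows "equivclp (joined S) (black_side L a) (black_side L b) \<longleftrightarrow> equivclp (next_black S) a b"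
proof
  show "equivclp (joined S) (black_side L a) (black_side L b)" if "equivclp (next_black S) a b"
    using that
  proof (induction rule: equivclp_induct)
    case (step y z)
    from step.hyps(2) have "equivclp (joined S) (black_side L y) (black_side L z)"
      by (rule disjE) (rule joined_next_black, assumption,
        rule equivclp_sym, rule joined_next_black, assumption)
    from equivclp_trans[OF step.IH this] show ?case .
  qed simp
next
  define base where "base h = end_of (if is_over L (fst h) then h else arc_partner L h)" for h
  define f where "f h = {c. equivclp (next_black S) (base h) c}" for h
  have f_eq: "f x = f y" if "next_black S (base x) (base y)" for x y
    using that unfolding f_def
    by (intro Collect_cong iffI) (meson equivclp_trans equivclp_sym r_into_equivclp)+
  have base_black: "base (black_side L e) = e" if "e \<in> edge_ends" for e
    using black_side(2,4)[OF that] by (simp add: base_def)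
  have base_under: "\<exists>e. base h = e \<and> e \<in> edge_ends \<and> arc_partner L (black_side L e) = h"
    if "h \<in> half_branches L" "\<not> is_over L (fst h)" for h
    using that arc_partner[OF that(1)] is_over_arc_partner[OF that(1)]
      black_side_end_of[of "arc_partner L h"] end_of_in[of "arc_partner L h"]
    by (simp add: base_def)
  have f_arc: "f x = f y" if "arc L x y" for x y
  proof -
    have x: "x \<in> half_branches L" using that by (auto simp: arc_def half_branches_def)
    have "y = arc_partner L x" using arc_partner(3)[OF x] that by blast
    then have "base x = base y"
      using is_over_arc_partner[OF x] arc_partner(2)[OF x] by (simp add: base_def)
    then show ?thesis by (simp add: f_def)
  qed
  have f_split: "f x = f y" if xy: "split_join L S x y" for x y
  proof -
    have x: "x \<in> half_branches L"
      using xy by (auto simp: split_join_def angle_def)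
    have q: "y = quarter_turn L x"
      using split_join_iff[OF x] xy by blast
    have y: "y \<in> half_branches L" "pos L (fst y) = pos L (fst x)"
      "is_over L (fst y) \<longleftrightarrow> \<not> is_over L (fst x)"
      using quarter_turn[OF x] q by auto
    show ?thesis
    proof (cases "is_over L (fst x)")
      case True
      \<comment> \<open>Here the splitting is of type \<open>B\<close>. The walk arrives at the
        under half-branch \<open>y\<close> and leaves along \<open>x\<close>, so its step goes from
        \<open>base y\<close> to \<open>base x\<close>.\<close>
      then have nS: "pos L (fst x) \<notin> S" using xy by (auto simp: split_join_def)
      obtain e where e: "base y = e" "e \<in> edge_ends" "arc_partner L (black_side L e) = y"
        using base_under y True by blast
      have "end_of x = alternating_rot L e"
        using alternating_rot_unique[OF e(2), of "end_of x"] e(3) q end_of_in[OF x]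
          black_side_end_of[OF True] by simp
      then have "next_black S (base y) (base x)"
        using True nS e by (auto simp: next_black_def base_def end_of_def)
      from f_eq[OF this] show ?thesis ..
    next
      case False
      then have inS: "pos L (fst x) \<in> S" using xy by (auto simp: split_join_def split: if_splits)
      have oy: "is_over L (fst y)" using y False by simp
      obtain e where e: "base x = e" "e \<in> edge_ends" "arc_partner L (black_side L e) = x"
        using base_under x False by blast
      have ey: "end_of y \<in> edge_ends" using end_of_in y by blast
      \<comment> \<open>Here the splitting is of type \<open>A\<close>. A half turn from
        \<open>y\<close> is three quarter turns from \<open>x\<close>, so one more quarter turn
        leads back to \<open>x\<close>; this identifies the value of
        \<open>alternating_rot L e\<close>.\<close>
      have "black_side L (other_end (end_of y)) = quarter_turn L (quarter_turn L y)"
        using quarter_turn_black_side[OF ey] black_side_end_of[OF oy] by simp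
      then have "quarter_turn L (black_side L (other_end (end_of y))) = x"
        using quarter_turn_4[OF x] q by simp
      then have r: "other_end (end_of y) = alternating_rot L e"
        using alternating_rot_unique[OF e(2), of "other_end (end_of y)"] e(3) ey
        by (simp add: other_end_def mem_Times_iff)
      have "end_of y = other_end (alternating_rot L e)"
        unfolding r[symmetric] by (simp add: other_end_def)
      moreover have "alternating_rot L e \<in> S \<times> UNIV"
        unfolding r[symmetric] using inS y(2) by (simp add: other_end_def end_of_def)
      moreover have "base y = end_of y"
        using oy by (simp add: base_def)
      ultimately have "next_black S (base x) (base y)"
        using e(1,2) by (simp add: next_black_def)
      then show ?thesis by (rule f_eq)
    qed
  qed
  assume "equivclp (joined S) (black_side L a) (black_side L b)"
  then have f_ab: "f (black_side L a) = f (black_side L b)"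
    by (rule equivclp_invariant) (use f_arc f_split in blast)
  have "b \<in> f (black_side L a)"
    unfolding f_ab unfolding f_def base_black[OF ab(2)] by simp
  then show "equivclp (next_black S) a b"
    unfolding f_def base_black[OF ab(1)] by simp
qed

text \<open>The first-return lemma with \<open>other_end\<close> as \<open>\<tau>\<close> turns the
  walk along state curves into the boundary walk of the spanning subgraph.\<close>

lemma equivclp_boundary_iff:
  assumes "S \<subseteq> classical L" and ab: "a \<in> S \<times> UNIV" "b \<in> S \<times> UNIV"
  shows "equivclp (joined S) (black_side L a) (black_side L b) \<longleftrightarrow>
    equivclp (\<lambda>x y. x \<in> S \<times> UNIV \<and>
      y = other_end (first_return (S \<times> UNIV) (alternating_rot L) x)) a b"
proof -
  have "finite edge_ends" using finite_classical by simp
  moreover have "S \<times> UNIV \<subseteq> edge_ends" using assms(1) by auto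
  moreover have "other_end x \<in> S \<times> UNIV" if "x \<in> S \<times> UNIV" for x :: "complex \<times> bool"
    using that by (auto simp: other_end_def)
  ultimately have "equivclp (next_black S) a b \<longleftrightarrow> equivclp (\<lambda>x y. x \<in> S \<times> UNIV \<and>
      y = other_end (first_return (S \<times> UNIV) (alternating_rot L) x)) a b"
    using first_return_equivclp[of edge_ends "alternating_rot L" "S \<times> UNIV" other_end a b]
      alternating_rot(1) inj_on_alternating_rot ab
    unfolding next_black_def[abs_def] by blast
  moreover have "a \<in> edge_ends" "b \<in> edge_ends" using assms by auto
  ultimately show ?thesis using equivclp_black_side_iff by simp
qed

text \<open>An under half-branch is joined by its splitting to an over one at the same crossing: its
  counterclockwise neighbour for type \<open>A\<close>, its clockwise neighbour for type
  \<open>B\<close>.\<close>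

lemma joined_to_black_side:
  assumes h: "h \<in> half_branches L"
  shows "\<exists>e\<in>edge_ends. fst e = pos L (fst h) \<and> equivclp (joined T) h (black_side L e)"
proof -
  have *: ?thesis if h': "h' \<in> half_branches L" "is_over L (fst h')" "pos L (fst h') = pos L (fst h)"
      "equivclp (joined T) h h'" for h'
    using h' end_of_in[OF h'(1)] black_side_end_of[OF h'(2)]
    by (intro bexI[of _ "end_of h'"]) (auto simp: end_of_def)
  consider "is_over L (fst h)" | "\<not> is_over L (fst h)" "pos L (fst h) \<in> T"
    | "\<not> is_over L (fst h)" "pos L (fst h) \<notin> T" by blast
  then show ?thesis
  proof cases
    case 1
    then show ?thesis using *[of h] h by simp
  next
    case 2
    then have "equivclp (joined T) h (quarter_turn L h)"
      using split_join_iff[OF h] by (intro joinedI) simp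
    then show ?thesis using *[of "quarter_turn L h"] 2 quarter_turn[OF h] by blast
  next
    case 3
    let ?k = "quarter_turn L (quarter_turn L (quarter_turn L h))"
    note k = quarter_turn_3[OF h]
    have "split_join L T ?k h"
      unfolding split_join_iff[OF k(1)] k(2,3,4) using 3 by simp
    then have "equivclp (joined T) h ?k" by (intro joinedI) simp
    then show ?thesis using *[of ?k] k(1,2,3) 3(1) by blast
  qed
qed

text \<open>A curve through a crossing of \<open>S\<close> contains a black side there. As
  \<open>T\<close> is arbitrary, this applies both to the state \<open>S\<close> and to the
  all-\<open>B\<close> state.\<close>

lemma class_meets_iff:
  assumes K: "K \<in> half_branches L // gen_equiv (joined T)" and S: "S \<subseteq> classical L"
  shows "K \<inter> {h. pos L (fst h) \<in> S} = {} \<longleftrightarrow> K \<inter> black_side L ` (S \<times> UNIV) = {}"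
proof
  assume "K \<inter> {h. pos L (fst h) \<in> S} = {}"
  then show "K \<inter> black_side L ` (S \<times> UNIV) = {}"
    using S black_side(3) by fastforce
next
  assume *: "K \<inter> black_side L ` (S \<times> UNIV) = {}"
  show "K \<inter> {h. pos L (fst h) \<in> S} = {}"
  proof (rule ccontr)
    assume "K \<inter> {h. pos L (fst h) \<in> S} \<noteq> {}"
    then obtain h where h: "h \<in> K" "pos L (fst h) \<in> S" by blast
    obtain q where q: "q \<in> half_branches L" "K = gen_equiv (joined T) `` {q}"
      using K by (rule quotientE)
    then have "equivclp (joined T) q h" using h(1) by simp
    then have "h \<in> half_branches L"
      using q(1) by (rule half_branch_invariant)
    from joined_to_black_side[OF this, of T]
    obtain e where e: "fst e = pos L (fst h)" "equivclp (joined T) h (black_side L e)"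
      by (elim bexE conjE) (rule that)
    then have "black_side L e \<in> K"
      using mem_class_gen_equiv[OF K h(1)] by simp
    moreover have "black_side L e \<in> black_side L ` (S \<times> UNIV)"
      using e(1) h(2) by (intro imageI) (simp add: mem_Times_iff)
    ultimately show False using * by blast
  qed
qed

section \<open>Counting state curves\<close>

lemma finite_crossing_free: "finite (crossing_free L)"
  by (rule finite_subset[of _ "{..<ncomp L}"]) (auto simp: crossing_free_def)

lemma finite_half_branch_quotient: "finite (half_branches L // r)"
  using finite_half_branches by (simp add: quotient_def)

lemma card_state_curves:
  assumes S: "S \<subseteq> classical L"
  shows "int (card (state_curves L S)) =
    num_boundary (spanning_subgraph (alternating_ribbon_graph L) S)"
proof -
  let ?H = "spanning_subgraph (alternating_ribbon_graph L) S"
  let ?B = "black_side L ` (S \<times> UNIV)" and ?D = "{h. pos L (fst h) \<in> S}"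
  let ?Q = "\<lambda>T. half_branches L // gen_equiv (joined T)"
  let ?s = "\<lambda>x y. x \<in> S \<times> UNIV \<and>
      y = other_end (first_return (S \<times> UNIV) (alternating_rot L) x)"
  have rel: "state_curve_rel L T = gen_equiv (joined T)" for T
    by (simp add: state_curve_rel_def)
  \<comment> \<open>The states \<open>S\<close> and \<open>{}\<close> differ only at crossings in
    \<open>S\<close>, i.e. on pairs inside \<open>?D\<close>, so they have the same curves off
    \<open>?D\<close>; \<open>?B\<close> and \<open>?D\<close> are met by the same curves.\<close>
  have avoid: "{K \<in> ?Q S. K \<inter> ?B = {}} = {K \<in> ?Q {}. K \<inter> ?B = {}}"
  proof -
    have "{K \<in> ?Q T. K \<inter> ?B = {}} = {K \<in> ?Q T. K \<inter> ?D = {}}" for T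
      using class_meets_iff[OF _ S] by blast
    moreover have "{K \<in> ?Q S. K \<inter> ?D = {}} = {K \<in> ?Q {}. K \<inter> ?D = {}}"
      by (rule quotient_avoiding_eq) (auto simp: split_join_def angle_def)
    ultimately show ?thesis by simp
  qed
  have meet: "card {K \<in> ?Q S. K \<inter> ?B \<noteq> {}} = card ((S \<times> UNIV) // gen_equiv ?s)"
    using S black_side(1) equivclp_boundary_iff[OF S] by (intro card_classes_meeting) fastforce+
  have split: "?Q S = {K \<in> ?Q S. K \<inter> ?B \<noteq> {}} \<union> {K \<in> ?Q S. K \<inter> ?B = {}}" by blast
  have cardQ: "card (?Q S) = card ((S \<times> UNIV) // gen_equiv ?s) + card {K \<in> ?Q {}. K \<inter> ?B = {}}"
    by (subst split, subst card_Un_disjoint)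
      (use finite_half_branch_quotient meet avoid in auto)
  have card_sum: "card (Inl ` U \<union> Inr ` crossing_free L :: (half_branch set + nat) set) =
      card U + card (crossing_free L)" if "finite U" for U
    using that finite_crossing_free
    by (subst card_Un_disjoint) (auto simp: card_image)
  \<comment> \<open>Vertices are curves of the all-\<open>B\<close> state, so those avoiding
    \<open>?B\<close> are the vertices that carry no edge-end of the subgraph.\<close>
  have "{K \<in> ?Q {}. K \<inter> ?B = {}} = ?Q {} - (\<lambda>h. gen_equiv (joined {}) `` {black_side L h}) ` (S \<times> UNIV)"
  proof (intro equalityI subsetI DiffI)
    fix K assume K: "K \<in> ?Q {} - (\<lambda>h. gen_equiv (joined {}) `` {black_side L h}) ` (S \<times> UNIV)"
    then show "K \<in> {K \<in> ?Q {}. K \<inter> ?B = {}}"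
      using mem_class_gen_equiv[of K "half_branches L" "joined {}"] by blast
  next
    fix K assume K: "K \<in> {K \<in> ?Q {}. K \<inter> ?B = {}}"
    then show "K \<in> ?Q {}" by simp
    show "K \<notin> (\<lambda>h. gen_equiv (joined {}) `` {black_side L h}) ` (S \<times> UNIV)"
    proof
      assume "K \<in> (\<lambda>h. gen_equiv (joined {}) `` {black_side L h}) ` (S \<times> UNIV)"
      then obtain h where h: "h \<in> S \<times> UNIV" "K = gen_equiv (joined {}) `` {black_side L h}"
        by (rule imageE)
      then have "black_side L h \<in> K" by simp
      with h(1) K show False by blast
    qed
  qed
  then have vb: "verts ?H - vert ?H ` ends ?H =
      Inl ` {K \<in> ?Q {}. K \<inter> ?B = {}} \<union> Inr ` crossing_free L"
    by (auto simp: spanning_subgraph_def alternating_ribbon_graph_def ends_def state_curves_def rel)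
  have "num_boundary ?H = int (card ((S \<times> UNIV) // gen_equiv ?s)) +
      int (card (verts ?H - vert ?H ` ends ?H))"
    by (simp add: num_boundary_def spanning_subgraph_def alternating_ribbon_graph_def ends_def
        first_return_def)
  also have "\<dots> = int (card (?Q S) + card (crossing_free L))"
    unfolding vb using cardQ finite_half_branch_quotient by (subst card_sum) auto
  also have "\<dots> = int (card (state_curves L S))"
    unfolding state_curves_def rel using finite_half_branch_quotient by (subst card_sum) auto
  finally show ?thesis by simp
qed

end


section \<open>Switching crossings\<close>

lemma switch_simps [simp]:
  "points (switch X L) = points L" "pos (switch X L) = pos L"
  "velocity (switch X L) = velocity L" "preimages (switch X L) = preimages L"
  "double_points (switch X L) = double_points L" "classical (switch X L) = classical L"
  "classical_points (switch X L) = classical_points L" "next_point (switch X L) = next_point L"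
  "half_branches (switch X L) = half_branches L" "arc (switch X L) = arc L"
  "outward (switch X L) = outward L" "angle (switch X L) = angle L"
  "generic_immersion (switch X L) = generic_immersion L"
  "crossing_free (switch X L) = crossing_free L" "ncomp (switch X L) = ncomp L"
  by (simp_all add: switch_def points_def pos_def[abs_def] velocity_def[abs_def]
      preimages_def[abs_def] double_points_def classical_points_def next_point_def[abs_def]
      half_branches_def arc_def[abs_def] outward_def[abs_def] angle_def[abs_def]
      generic_immersion_def crossing_free_def cong: if_cong)

context link_diagram
begin

lemma under_eq_opposite_point:
  assumes "c \<in> classical L"
  shows "under L c = opposite_point L (over L c)"
  using over_classical[OF assms] by (simp add: under_def opposite_point_def)

lemma switch_diagram: "virtual_link_diagram (switch X L)"
proof -
  have "over (switch X L) c \<in> preimages L c" if c: "c \<in> classical L" for c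
  proof -
    note o = over_classical[OF c]
    have "over L c \<in> preimages L c" "under L c \<in> preimages L c"
      unfolding mem_preimages_classical[OF c] under_eq_opposite_point[OF c]
      using o opposite_point(1,2)[OF o(1)] by simp_all
    then show ?thesis by (simp add: switch_def)
  qed
  then show ?thesis
    using diagram unfolding virtual_link_diagram_def switch_simps by blast
qed

lemma is_over_switch:
  assumes p: "p \<in> classical_points L"
  shows "is_over (switch X L) p \<longleftrightarrow> (if pos L p \<in> X then \<not> is_over L p else is_over L p)"
proof -
  let ?c = "pos L p"
  have c: "?c \<in> classical L" using pos_classical[OF p] .
  have "p = over L ?c \<or> p = opposite_point L (over L ?c)"
    using same_pos_cases[OF over_classical(1)[OF c] p] over_classical(2)[OF c] by simp
  moreover have "over (switch X L) ?c = (if ?c \<in> X then opposite_point L (over L ?c) else over L ?c)"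
    using under_eq_opposite_point[OF c] by (simp add: switch_def)
  moreover note opposite_point(3)[OF over_classical(1)[OF c]]
  ultimately show ?thesis
    unfolding is_over_def switch_simps by metis
qed

text \<open>Switching a crossing exchanges its two splittings, so changing the type of splitting
  exactly on \<open>X\<close> restores the same joins.\<close>

lemma split_join_switch: "split_join (switch X L) (S - X \<union> (X - S)) = split_join L S"
proof (intro ext)
  fix h h'
  show "split_join (switch X L) (S - X \<union> (X - S)) h h' = split_join L S h h'"
    using is_over_switch[of "fst h" X]
    by (auto simp: split_join_def angle_def half_branches_def)
qed

lemma state_curves_switch: "state_curves (switch X L) (S - X \<union> (X - S)) = state_curves L S"
  by (simp add: state_curves_def state_curve_rel_def split_join_switch)

end


section \<open>The bracket and the Bollobas-Riordan polynomial\<close>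

text \<open>The exponents are collected for each variable. Those of \<open>A\<close> and
  \<open>B\<close> reduce by \<open>rF + nF = eF\<close> and \<open>r + n = e\<close>, that of
  \<open>d\<close> by \<open>r + k = rF + kF\<close>, as both equal \<open>v\<close>. Here
  \<open>t\<close> stands for twice \<open>s(F)\<close>.\<close>

lemma weight_identity:
  fixes A B d :: "'a::field" and r n k v rF nF kF bF eF e t :: int
  assumes nz: "A \<noteq> 0" "B \<noteq> 0" "d \<noteq> 0"
    and "r = v - k" "n = e - r" "rF = v - kF" "nF = eF - rF"
  shows "A powi r * B powi n * d powi (k - 1) *
      ((B * d / A) powi (r - rF) * (A * d / B) powi nF * (B / A) powi t *
       (1 / d) powi (kF - bF + nF)) =
    A powi (eF - t) * B powi (e - eF + t) * d powi (bF - 1)"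
proof -
  have *: "x powi (i + j) = x powi i * x powi j" if "x \<noteq> 0" for x :: 'a and i j
    using that by (simp add: power_int_add)
  have "A powi r * B powi n * d powi (k - 1) *
      ((B * d / A) powi (r - rF) * (A * d / B) powi nF * (B / A) powi t *
       (1 / d) powi (kF - bF + nF)) =
    (A powi r * A powi (- (r - rF)) * A powi nF * A powi (- t)) *
    (B powi n * B powi (r - rF) * B powi (- nF) * B powi t) *
    (d powi (k - 1) * d powi (r - rF) * d powi nF * d powi (- (kF - bF + nF)))"
    by (simp add: power_int_mult_distrib power_int_divide_distrib power_int_minus
        power_int_inverse divide_inverse del: minus_diff_eq minus_add_distrib)
  also have "\<dots> = A powi (r + - (r - rF) + nF + - t) * B powi (n + (r - rF) + - nF + t) *
    d powi ((k - 1) + (r - rF) + nF + - (kF - bF + nF))"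
    by (simp only: nz[THEN *])
  also have "\<dots> = A powi (eF - t) * B powi (e - eF + t) * d powi (bF - 1)"
  proof -
    have "r + - (r - rF) + nF + - t = eF - t" "n + (r - rF) + - nF + t = e - eF + t"
      "(k - 1) + (r - rF) + nF + - (kF - bF + nF) = bF - 1"
      using assms(4-) by linarith+
    then show ?thesis by (simp only:)
  qed
  finally show ?thesis .
qed

lemma twice_s_diagram_ribbon_graph:
  assumes X: "X \<subseteq> classical L"
  shows "twice_s (diagram_ribbon_graph L X) F = int (card (F \<inter> X)) - int (card (X - F))"
proof -
  have "num_negative (spanning_subgraph (diagram_ribbon_graph L X) F') = int (card (F' \<inter> X))" for F'
    by (auto simp: num_negative_def spanning_subgraph_def diagram_ribbon_graph_def
        ribbon_graph.extend_def signed_ribbon_graph.fields_def intro!: arg_cong[where f = card])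
  moreover have "(classical L - F) \<inter> X = X - F" using X by auto
  ultimately show ?thesis
    by (simp add: twice_s_def diagram_ribbon_graph_def ribbon_graph.extend_def
        alternating_ribbon_graph_def)
qed

theorem theorem4p1:
  fixes L :: vlink and X :: "complex set" and A B d :: "'a::field"
  defines "G \<equiv> diagram_ribbon_graph L X"
  assumes "virtual_link_diagram L"
    and "checkerboard_colorable L"
    and "X \<subseteq> classical L" and "alternating (switch X L)"
    and "A \<noteq> 0" and "B \<noteq> 0" and "d \<noteq> 0"
  shows "kauffman_bracket L A B d =
    A powi graph_rank G * B powi nullity G * d powi (num_components G - 1) *
    signed_BR G (B * d / A) (A * d / B) (B / A) (1 / d)"
proof -
  interpret L: link_diagram L using assms(2) by unfold_locales
  interpret M: alternating_diagram "switch X L"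
    using L.switch_diagram assms(5) by unfold_locales
  let ?E = "classical L"
  let ?H = "spanning_subgraph G"
  \<comment> \<open>\<open>\<phi> S\<close> is the set of crossings where the switched diagram needs
    an \<open>A\<close>-splitting to give the curves of \<open>S\<close>; the map is its own
    inverse.\<close>
  define \<phi> where "\<phi> S = S - X \<union> (X - S)" for S
  have bij: "bij_betw \<phi> (Pow ?E) (Pow ?E)"
    by (rule bij_betw_byWitness[where f' = \<phi>]) (use assms(4) in \<open>auto simp: \<phi>_def\<close>)
  have edges_G: "edges G = ?E"
    by (simp add: G_def diagram_ribbon_graph_def ribbon_graph.extend_def alternating_ribbon_graph_def)
  have boundary: "num_boundary (?H F) =
      num_boundary (spanning_subgraph (alternating_ribbon_graph (switch X L)) F)" for F
    by (simp add: G_def diagram_ribbon_graph_def ribbon_graph.extend_def spanning_subgraph_def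
        num_boundary_def ends_def)
  have term_eq: "A ^ card S * B ^ card (?E - S) * d powi (int (card (state_curves L S)) - 1) =
    A powi graph_rank G * B powi nullity G * d powi (num_components G - 1) *
    ((B * d / A) powi (graph_rank G - graph_rank (?H (\<phi> S))) *
     (A * d / B) powi nullity (?H (\<phi> S)) * (B / A) powi twice_s G (\<phi> S) *
     (1 / d) powi (num_components (?H (\<phi> S)) - num_boundary (?H (\<phi> S)) + nullity (?H (\<phi> S))))"
    if S: "S \<subseteq> ?E" for S
  proof -
    let ?F = "\<phi> S"
    have F: "?F \<subseteq> ?E" using S assms(4) by (auto simp: \<phi>_def)
    have fin: "finite S" "finite X" "finite ?E"
      using S assms(4) L.finite_classical finite_subset by blast+
    have cards: "card S = card (S - X) + card (X \<inter> S)" "card ?F = card (S - X) + card (X - S)"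
      unfolding \<phi>_def using fin card_Int_Diff[of S X]
      by (simp add: Int_commute, intro card_Un_disjoint) auto
    \<comment> \<open>Negative edges in \<open>?F\<close> are crossings with a
      \<open>B\<close>-splitting in \<open>S\<close>, negative edges outside \<open>?F\<close> are
      crossings with an \<open>A\<close>-splitting. Subtracting \<open>twice_s\<close> from the edge
      count thus yields the number of \<open>A\<close>-splittings.\<close>
    have FX: "?F \<inter> X = X - S" "X - ?F = X \<inter> S" by (auto simp: \<phi>_def)
    have a: "int (card ?F) - twice_s G ?F = int (card S)"
      using cards unfolding G_def twice_s_diagram_ribbon_graph[OF assms(4)] FX by simp
    have b: "int (card ?E) - int (card ?F) + twice_s G ?F = int (card (?E - S))"
      using a card_Diff_subset[of S ?E] card_mono[of ?E S] S fin by (simp add: of_nat_diff)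
    have c: "num_boundary (?H ?F) = int (card (state_curves L S))"
      using M.card_state_curves[of ?F] F L.state_curves_switch[of X S] boundary
      by (simp add: \<phi>_def)
    have "A powi graph_rank G * B powi nullity G * d powi (num_components G - 1) *
      ((B * d / A) powi (graph_rank G - graph_rank (?H ?F)) *
       (A * d / B) powi nullity (?H ?F) * (B / A) powi twice_s G ?F *
       (1 / d) powi (num_components (?H ?F) - num_boundary (?H ?F) + nullity (?H ?F))) =
      A powi (int (card ?F) - twice_s G ?F) * B powi (int (card ?E) - int (card ?F) + twice_s G ?F) *
      d powi (num_boundary (?H ?F) - 1)"
      \<comment> \<open>A spanning subgraph keeps all vertices, so one \<open>v\<close> serves both
        graphs.\<close>
      by (rule weight_identity[OF assms(6-8), where v = "num_verts G"])
        (simp_all add: graph_rank_def nullity_def num_verts_def num_edges_def edges_G,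
          simp_all add: spanning_subgraph_def)
    then show ?thesis unfolding a b c by simp
  qed
  have "kauffman_bracket L A B d = (\<Sum>S\<in>Pow ?E.
    A powi graph_rank G * B powi nullity G * d powi (num_components G - 1) *
    ((B * d / A) powi (graph_rank G - graph_rank (?H (\<phi> S))) *
     (A * d / B) powi nullity (?H (\<phi> S)) * (B / A) powi twice_s G (\<phi> S) *
     (1 / d) powi (num_components (?H (\<phi> S)) - num_boundary (?H (\<phi> S)) + nullity (?H (\<phi> S)))))"
    unfolding kauffman_bracket_def by (rule sum.cong) (use term_eq in auto)
  also have "\<dots> = (\<Sum>F\<in>Pow ?E.
    A powi graph_rank G * B powi nullity G * d powi (num_components G - 1) *
    ((B * d / A) powi (graph_rank G - graph_rank (?H F)) *
     (A * d / B) powi nullity (?H F) * (B / A) powi twice_s G F *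
     (1 / d) powi (num_components (?H F) - num_boundary (?H F) + nullity (?H F))))"
    by (rule sum.reindex_bij_betw[OF bij])
  finally show ?thesis
    by (simp add: signed_BR_def Let_def edges_G sum_distrib_left)
qed

end
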